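(* Let $g$ be a left-invariant Lorentzian structure on the group $G=\mathrm{Aff}_+(\mathbb R)$, written as $g(u_1X_1+u_2X_2)=-(au_1+bu_2)^2+(cu_1+du_2)^2$ with $A=\begin{pmatrix}a&b\\c&d\end{pmatrix}$, $|A|=ad-bc>0$. Then $(G,g)$ has constant sectional curvature $$K=\frac{g(X_1)}{|A|^2},$$ where $g(X_1)=c^2-a^2$.
   Context: $G=\mathrm{Aff}_+(\mathbb R)=\{(x,y)\in\mathbb R^2: y>0\}$ with product $(x_2,y_2)\cdot(x_1,y_1)=(x_2+y_2x_1,\,y_2y_1)$ and identity $\mathrm{Id}=(0,1)$. The vector fields $X_1=y\,\partial_x$, $X_2=y\,\partial_y$ form a left-invariant frame. A Lorentzian structure is a nondegenerate quadratic form $g$ of index 1 on the tangent spaces (the associated bilinear form is also written $g(\cdot,\cdot)$); it is left-invariant if the coefficients of $g$ in the frame $X_1,X_2$ are constant. Every left-invariant Lorentzian structure can be written as $g(u_1X_1+u_2X_2)=-(au_1+bu_2)^2+(cu_1+du_2)^2$ for some real matrix $A=\begin{pmatrix}a&b\\c&d\end{pmatrix}$ with $|A|=\det A>0$. Sign conventions for curvature: let $D$ be the Levi-Civita connection of $g$, $R_{XY}Z=D_{[X,Y]}Z-[D_X,D_Y]Z$ and $Q(v,w)=g(v,v)g(w,w)-g(v,w)^2$. For a nondegenerate 2-plane $P\subset T_qG$ with basis $v,w$ (that is, $Q(v,w)\ne0$) the sectional curvature is $K(q,P)=g(R_{vw}v,w)/Q(v,w)$. Constant curvature $K$ means that all nondegenerate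 plane sections have sectional curvature $K$. *)

theory Defs
  imports "HOL-Analysis.Analysis"
begin

section \<open>Smooth maps and vector fields on open sets\<close>

text \<open>All notions below are meant for open \<open>U\<close>.  The tangent space at every point of \<open>U\<close> is
  identified with the ambient space, so a vector field is a map from points to vectors; its
  values outside \<open>U\<close> are irrelevant.\<close>

primrec Ck_on :: "nat \<Rightarrow> 'a::euclidean_space set \<Rightarrow> ('a \<Rightarrow> 'b::real_normed_vector) \<Rightarrow> bool" where
  "Ck_on 0 U f \<longleftrightarrow> continuous_on U f"
| "Ck_on (Suc k) U f \<longleftrightarrow>
     f differentiable_on U \<and> (\<forall>v. Ck_on k U (\<lambda>x. frechet_derivative f (at x) v))"

definition smooth_on :: "'a::euclidean_space set \<Rightarrow> ('a \<Rightarrow> 'b::real_normed_vector) \<Rightarrow> bool" where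
  "smooth_on U f \<longleftrightarrow> (\<forall>k. Ck_on k U f)"

abbreviation vector_field :: "'a::euclidean_space set \<Rightarrow> ('a \<Rightarrow> 'a) \<Rightarrow> bool" where
  "vector_field U X \<equiv> smooth_on U X"

text \<open>The derivative \<open>X f\<close> of a (scalar or vector valued) map along a vector field.\<close>

definition deriv_along :: "('a::euclidean_space \<Rightarrow> 'a) \<Rightarrow> ('a \<Rightarrow> 'b::real_normed_vector) \<Rightarrow> 'a \<Rightarrow> 'b" where
  "deriv_along X f p = frechet_derivative f (at p) (X p)"

text \<open>With this sign, \<open>[X, Y] f = X (Y f) - Y (X f)\<close> for functions \<open>f\<close>.\<close>

definition lie_bracket :: "('a::euclidean_space \<Rightarrow> 'a) \<Rightarrow> ('a \<Rightarrow> 'a) \<Rightarrow> 'a \<Rightarrow> 'a" where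
  "lie_bracket X Y p = deriv_along X Y p - deriv_along Y X p"


section \<open>Quadratic forms and Lorentzian structures\<close>

definition polar :: "('a::real_vector \<Rightarrow> real) \<Rightarrow> 'a \<Rightarrow> 'a \<Rightarrow> real" where
  "polar q v w = (q (v + w) - q v - q w) / 2"

definition quadratic_form :: "('a::real_vector \<Rightarrow> real) \<Rightarrow> bool" where
  "quadratic_form q \<longleftrightarrow> (\<forall>t v. q (t *\<^sub>R v) = t\<^sup>2 * q v) \<and> bilinear (polar q)"

definition nondegenerate_form :: "('a::real_vector \<Rightarrow> real) \<Rightarrow> bool" where
  "nondegenerate_form q \<longleftrightarrow> (\<forall>v. (\<forall>w. polar q v w = 0) \<longrightarrow> v = 0)"

text \<open>The index: the maximal dimension of a subspace on which the form is negative definite.\<close>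

definition form_index :: "('a::euclidean_space \<Rightarrow> real) \<Rightarrow> nat" where
  "form_index q = Max {dim V | V. subspace V \<and> (\<forall>v\<in>V - {0}. q v < 0)}"

definition lorentzian_structure :: "'a::euclidean_space set \<Rightarrow> ('a \<Rightarrow> 'a \<Rightarrow> real) \<Rightarrow> bool" where
  "lorentzian_structure U g \<longleftrightarrow>
     (\<forall>p\<in>U. quadratic_form (g p) \<and> nondegenerate_form (g p) \<and> form_index (g p) = 1) \<and>
     (\<forall>v. smooth_on U (\<lambda>p. g p v))"


section \<open>The Levi-Civita connection and curvature\<close>

text \<open>A connection acts on vector fields on \<open>U\<close>; its axioms only constrain values on \<open>U\<close>.\<close>

definition connection_on ::
    "'a::euclidean_space set \<Rightarrow> (('a \<Rightarrow> 'a) \<Rightarrow> ('a \<Rightarrow> 'a) \<Rightarrow> 'a \<Rightarrow> 'a) \<Rightarrow> bool" where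
  "connection_on U D \<longleftrightarrow>
     (\<forall>X Y. vector_field U X \<longrightarrow> vector_field U Y \<longrightarrow> vector_field U (D X Y)) \<and>
     (\<forall>X Y Z. vector_field U X \<longrightarrow> vector_field U Y \<longrightarrow> vector_field U Z \<longrightarrow>
        (\<forall>p\<in>U. D (\<lambda>r. X r + Y r) Z p = D X Z p + D Y Z p \<and>
               D X (\<lambda>r. Y r + Z r) p = D X Y p + D X Z p)) \<and>
     (\<forall>f X Y. smooth_on U (f :: 'a \<Rightarrow> real) \<longrightarrow> vector_field U X \<longrightarrow> vector_field U Y \<longrightarrow>
        (\<forall>p\<in>U. D (\<lambda>r. f r *\<^sub>R X r) Y p = f p *\<^sub>R D X Y p \<and>
               D X (\<lambda>r. f r *\<^sub>R Y r) p = deriv_along X f p *\<^sub>R Y p + f p *\<^sub>R D X Y p))"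

definition is_levi_civita ::
    "'a::euclidean_space set \<Rightarrow> ('a \<Rightarrow> 'a \<Rightarrow> real) \<Rightarrow> (('a \<Rightarrow> 'a) \<Rightarrow> ('a \<Rightarrow> 'a) \<Rightarrow> 'a \<Rightarrow> 'a) \<Rightarrow> bool" where
  "is_levi_civita U g D \<longleftrightarrow> connection_on U D \<and>
     (\<forall>X Y. vector_field U X \<longrightarrow> vector_field U Y \<longrightarrow>
        (\<forall>p\<in>U. D X Y p - D Y X p = lie_bracket X Y p)) \<and>
     (\<forall>X Y Z. vector_field U X \<longrightarrow> vector_field U Y \<longrightarrow> vector_field U Z \<longrightarrow>
        (\<forall>p\<in>U. deriv_along X (\<lambda>r. polar (g r) (Y r) (Z r)) p =
           polar (g p) (D X Y p) (Z p) + polar (g p) (Y p) (D X Z p)))"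

text \<open>On smooth fields and on \<open>U\<close> the Levi-Civita connection is unique; the choice operator only
  fixes the irrelevant values elsewhere.\<close>

definition levi_civita ::
    "'a::euclidean_space set \<Rightarrow> ('a \<Rightarrow> 'a \<Rightarrow> real) \<Rightarrow> ('a \<Rightarrow> 'a) \<Rightarrow> ('a \<Rightarrow> 'a) \<Rightarrow> 'a \<Rightarrow> 'a" where
  "levi_civita U g = (SOME D. is_levi_civita U g D)"

text \<open>The sign convention is \<open>R\<^bsub>XY\<^esub> Z = D\<^bsub>[X,Y]\<^esub> Z - [D\<^bsub>X\<^esub>, D\<^bsub>Y\<^esub>] Z\<close>.\<close>

definition curvature_field ::
    "(('a::euclidean_space \<Rightarrow> 'a) \<Rightarrow> ('a \<Rightarrow> 'a) \<Rightarrow> 'a \<Rightarrow> 'a)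
       \<Rightarrow> ('a \<Rightarrow> 'a) \<Rightarrow> ('a \<Rightarrow> 'a) \<Rightarrow> ('a \<Rightarrow> 'a) \<Rightarrow> 'a \<Rightarrow> 'a" where
  "curvature_field D X Y Z p = D (lie_bracket X Y) Z p - (D X (D Y Z) p - D Y (D X Z) p)"

text \<open>Its value on tangent vectors at \<open>q\<close>: the common value for all extensions to vector fields.\<close>

definition curvature_tensor ::
    "'a::euclidean_space set \<Rightarrow> ('a \<Rightarrow> 'a \<Rightarrow> real) \<Rightarrow> 'a \<Rightarrow> 'a \<Rightarrow> 'a \<Rightarrow> 'a \<Rightarrow> 'a" where
  "curvature_tensor U g q v w z =
     (THE r. \<forall>X Y Z. vector_field U X \<and> vector_field U Y \<and> vector_field U Z \<and>
                     X q = v \<and> Y q = w \<and> Z q = z \<longrightarrow>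
                     curvature_field (levi_civita U g) X Y Z q = r)"

definition gram_Q :: "('a::real_vector \<Rightarrow> real) \<Rightarrow> 'a \<Rightarrow> 'a \<Rightarrow> real" where
  "gram_Q q v w = polar q v v * polar q w w - (polar q v w)\<^sup>2"

definition plane_basis :: "'a::euclidean_space set \<Rightarrow> 'a \<Rightarrow> 'a \<Rightarrow> bool" where
  "plane_basis P v w \<longleftrightarrow> v \<noteq> w \<and> independent {v, w} \<and> span {v, w} = P"

definition nondegenerate_plane :: "('a::euclidean_space \<Rightarrow> real) \<Rightarrow> 'a set \<Rightarrow> bool" where
  "nondegenerate_plane q P \<longleftrightarrow> (\<exists>v w. plane_basis P v w \<and> gram_Q q v w \<noteq> 0)"

text \<open>For a nondegenerate plane the quotient is the same for every basis.\<close>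

definition sectional_curvature ::
    "'a::euclidean_space set \<Rightarrow> ('a \<Rightarrow> 'a \<Rightarrow> real) \<Rightarrow> 'a \<Rightarrow> 'a set \<Rightarrow> real" where
  "sectional_curvature U g q P =
     (THE k. \<forall>v w. plane_basis P v w \<longrightarrow>
        k = polar (g q) (curvature_tensor U g q v w v) w / gram_Q (g q) v w)"

definition has_constant_curvature ::
    "'a::euclidean_space set \<Rightarrow> ('a \<Rightarrow> 'a \<Rightarrow> real) \<Rightarrow> real \<Rightarrow> bool" where
  "has_constant_curvature U g K \<longleftrightarrow>
     (\<forall>q\<in>U. \<forall>P. nondegenerate_plane (g q) P \<longrightarrow> sectional_curvature U g q P = K)"


section \<open>The group of orientation preserving affine maps of the line\<close>

definition Aff :: "(real \<times> real) set" where
  "Aff = {p. snd p > 0}"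

definition aff_mult :: "real \<times> real \<Rightarrow> real \<times> real \<Rightarrow> real \<times> real" where
  "aff_mult p2 p1 = (fst p2 + snd p2 * fst p1, snd p2 * snd p1)"

definition aff_id :: "real \<times> real" where
  "aff_id = (0, 1)"

definition X1 :: "real \<times> real \<Rightarrow> real \<times> real" where
  "X1 p = (snd p, 0)"

definition X2 :: "real \<times> real \<Rightarrow> real \<times> real" where
  "X2 p = (0, snd p)"

text \<open>The frame is left-invariant: \<open>X\<^sub>i\<close> at \<open>p\<close> times \<open>q\<close> is the image of \<open>X\<^sub>i\<close> at \<open>q\<close> under the
  differential of the left translation by \<open>p\<close>.\<close>

lemma frame_left_invariant:
  shows "frechet_derivative (aff_mult p) (at q) (X1 q) = X1 (aff_mult p q)"
    and "frechet_derivative (aff_mult p) (at q) (X2 q) = X2 (aff_mult p q)"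
proof -
  have "((\<lambda>r. (fst p + snd p * fst r, snd p * snd r)) has_derivative
          (\<lambda>h. (snd p * fst h, snd p * snd h))) (at q)"
    by (auto intro!: derivative_eq_intros)
  then have "(aff_mult p has_derivative (\<lambda>h. (snd p * fst h, snd p * snd h))) (at q)"
    unfolding aff_mult_def .
  then have *: "frechet_derivative (aff_mult p) (at q) = (\<lambda>h. (snd p * fst h, snd p * snd h))"
    by (metis frechet_derivative_at)
  show "frechet_derivative (aff_mult p) (at q) (X1 q) = X1 (aff_mult p q)"
    and "frechet_derivative (aff_mult p) (at q) (X2 q) = X2 (aff_mult p q)"
    by (simp_all add: * X1_def X2_def aff_mult_def)
qed

text \<open>Left-invariance of a structure: its coefficients in the frame \<open>X\<^sub>1, X\<^sub>2\<close> are constant.\<close>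

definition left_invariant :: "(real \<times> real \<Rightarrow> real \<times> real \<Rightarrow> real) \<Rightarrow> bool" where
  "left_invariant g \<longleftrightarrow>
     (\<exists>E F H. \<forall>p\<in>Aff. polar (g p) (X1 p) (X1 p) = E \<and> polar (g p) (X1 p) (X2 p) = F \<and>
                      polar (g p) (X2 p) (X2 p) = H)"

end

theory Submission
  imports Defs
begin

text \<open>
  In the coordinates \<open>(x, y)\<close> of the group the frame is \<open>y\<close> times the coordinate frame, so a
  left-invariant structure is \<open>g\<^bsub>(x,y)\<^esub> = q / y\<^sup>2\<close> with a constant quadratic form \<open>q\<close>: it is the
  half-plane model, with an indefinite form in place of the Euclidean one.  Since \<open>q\<close> is
  nondegenerate, the coordinate \<open>y\<close> is \<open>\<langle>n, \<cdot>\<rangle>\<close> for a unique vector \<open>n\<close>, where \<open>\<langle>\<cdot>, \<cdot>\<rangle>\<close> is the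
  polar form of \<open>q\<close>.  The computation is done in this invariant form, on the half-space
  \<open>{p. \<langle>n, p\<rangle> > 0}\<close> of any Euclidean space, and gives the constant curvature \<open>- q n\<close>.

  The metric \<open>q / \<langle>n, p\<rangle>\<^sup>2\<close> is conformal to a flat one, so its Levi-Civita connection is
  \<open>D\<^bsub>X\<^esub> Y = dY(X) + C(X, Y) / \<langle>n, p\<rangle>\<close> with the constant symmetric bilinear map
  \<open>C(v, w) = \<langle>v, w\<rangle> n - \<langle>n, v\<rangle> w - \<langle>n, w\<rangle> v\<close>.  In the curvature the second derivatives of the
  fields cancel by the symmetry of second derivatives, the first derivatives cancel by the
  symmetry of \<open>C\<close>, and what remains is an algebraic identity for \<open>C\<close>
  (\<open>christoffel_curvature\<close>); the result is
  \<open>R\<^bsub>vw\<^esub> z = - q n (g(v, z) w - g(w, z) v)\<close>, which means constant curvature \<open>- q n\<close>.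

  As the Levi-Civita connection is introduced by choice, one needs both that the connection above
  has the defining properties and that these determine it (\<open>levi_civita_unique\<close>).  As smoothness
  is a condition on iterated Frechet derivatives, the closure of smooth maps under the operations
  that occur has to be established first.

  For \<open>Aff\<close>, solving \<open>\<langle>n, \<cdot>\<rangle> = dy\<close> gives \<open>n = (c d - a b, a\<^sup>2 - c\<^sup>2) / |A|\<^sup>2\<close>, whence
  \<open>- q n = - \<langle>n, n\<rangle> = - dy(n) = (c\<^sup>2 - a\<^sup>2) / |A|\<^sup>2\<close>.
\<close>

section \<open>Smooth maps\<close>

lemma Ck_on_Suc_imp: "Ck_on (Suc k) U f \<Longrightarrow> Ck_on k U f"
proof (induction k arbitrary: f)
  case 0
  then show ?case by (simp add: differentiable_imp_continuous_on)
next
  case (Suc k)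
  then show ?case by (metis Ck_on.simps(2))
qed

text \<open>Openness is essential: \<open>frechet_derivative f (at x)\<close> sees a full neighbourhood of \<open>x\<close>.\<close>

lemma Ck_on_cong:
  assumes "open U" "\<And>x. x \<in> U \<Longrightarrow> f x = g x" "Ck_on k U f"
  shows "Ck_on k U g"
  using assms(2,3)
proof (induction k arbitrary: f g)
  case 0
  then show ?case by (metis Ck_on.simps(1) continuous_on_cong)
next
  case (Suc k)
  have diff: "f differentiable at x" if "x \<in> U" for x
    using Suc.prems(2) that assms(1) by (simp add: differentiable_on_eq_differentiable_at)
  have der: "(g has_derivative frechet_derivative f (at x)) (at x)" if "x \<in> U" for x
    using diff[OF that] Suc.prems(1) that assms(1)
    by (metis frechet_derivative_works has_derivative_transform_within_open)
  have "frechet_derivative f (at x) v = frechet_derivative g (at x) v" if "x \<in> U" for x v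
    using frechet_derivative_at[OF der[OF that]] by simp
  moreover have "g differentiable_on U"
    using der by (meson differentiable_at_imp_differentiable_on differentiable_def)
  ultimately show ?case
    using Suc.IH Suc.prems(2) by (metis (no_types, lifting) Ck_on.simps(2))
qed

text \<open>The way in which smoothness is proved below: exhibit any derivative, without evaluating
  the choice operator in \<open>frechet_derivative\<close>.\<close>

lemma Ck_on_SucI:
  assumes "open U" "\<And>x. x \<in> U \<Longrightarrow> (f has_derivative f' x) (at x)"
    and "\<And>v. Ck_on k U (\<lambda>x. f' x v)"
  shows "Ck_on (Suc k) U f"
proof -
  have "frechet_derivative f (at x) = f' x" if "x \<in> U" for x
    using frechet_derivative_at[OF assms(2)[OF that]] by simp
  then have "Ck_on k U (\<lambda>x. frechet_derivative f (at x) v)" for v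
    by (intro Ck_on_cong[OF assms(1) _ assms(3)]) simp
  moreover have "f differentiable_on U"
    using assms(2) by (meson differentiable_at_imp_differentiable_on differentiable_def)
  ultimately show ?thesis by simp
qed

lemma Ck_on_has_derivative:
  assumes "open U" "Ck_on (Suc k) U f" "x \<in> U"
  shows "(f has_derivative frechet_derivative f (at x)) (at x)"
  using assms by (simp add: differentiable_on_eq_differentiable_at flip: frechet_derivative_works)

lemma Ck_on_const: "open U \<Longrightarrow> Ck_on k U (\<lambda>x. c)"
proof (induction k arbitrary: c)
  case (Suc k)
  show ?case
    by (rule Ck_on_SucI[OF Suc.prems has_derivative_const]) (rule Suc.IH[OF Suc.prems])
qed simp

lemma Ck_on_bounded_linear:
  assumes "open U" "bounded_linear f"
  shows "Ck_on k U f"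
proof (cases k)
  case 0
  then show ?thesis using assms by (simp add: linear_continuous_on)
next
  case (Suc m)
  have "Ck_on (Suc m) U f"
    by (rule Ck_on_SucI[OF assms(1) bounded_linear_imp_has_derivative[OF assms(2)]])
      (rule Ck_on_const[OF assms(1)])
  then show ?thesis using Suc by simp
qed

lemma Ck_on_add:
  assumes "open U" "Ck_on k U f" "Ck_on k U g"
  shows "Ck_on k U (\<lambda>x. f x + g x)"
  using assms(2,3)
proof (induction k arbitrary: f g)
  case 0
  then show ?case by (simp add: continuous_on_add)
next
  case (Suc k)
  show ?case
    by (rule Ck_on_SucI[OF assms(1) has_derivative_add
          [OF Ck_on_has_derivative[OF assms(1) Suc.prems(1)]
              Ck_on_has_derivative[OF assms(1) Suc.prems(2)]]])
      (use Suc in auto)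
qed

text \<open>By Leibniz' rule the derivative of a product is a sum of products of maps of class \<open>k\<close>, one
  factor being weakened from class \<open>k + 1\<close>; this feeds the induction.\<close>

lemma (in bounded_bilinear) Ck_on:
  assumes "open U" "Ck_on k U f" "Ck_on k U g"
  shows "Ck_on k U (\<lambda>x. prod (f x) (g x))"
  using assms(2,3)
proof (induction k arbitrary: f g)
  case 0
  then show ?case by (simp add: continuous_on)
next
  case (Suc k)
  note fg = Suc.prems[THEN Ck_on_Suc_imp]
  show ?case
    by (rule Ck_on_SucI[OF assms(1) FDERIV
          [OF Ck_on_has_derivative[OF assms(1) Suc.prems(1)]
              Ck_on_has_derivative[OF assms(1) Suc.prems(2)]]])
      (use Suc fg in \<open>auto intro!: Ck_on_add[OF assms(1)]\<close>)
qed

text \<open>The derivative \<open>- f'/f\<^sup>2\<close> of \<open>1/f\<close> involves only \<open>f'\<close> and \<open>1/f\<close> itself, which is of class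
  \<open>k\<close> by induction.\<close>

lemma Ck_on_inverse:
  fixes f :: "'a::euclidean_space \<Rightarrow> real"
  assumes "open U" "Ck_on k U f" "\<And>x. x \<in> U \<Longrightarrow> f x \<noteq> 0"
  shows "Ck_on k U (\<lambda>x. inverse (f x))"
  using assms(2)
proof (induction k)
  case 0
  then show ?case using assms(3) by (auto intro: continuous_on_inverse)
next
  case (Suc k)
  have inv: "Ck_on k U (\<lambda>x. inverse (f x))"
    using Suc.IH Ck_on_Suc_imp[OF Suc.prems] .
  have der: "((\<lambda>x. inverse (f x)) has_derivative
      (\<lambda>v. (- 1) * (inverse (f x) * frechet_derivative f (at x) v * inverse (f x)))) (at x)" if "x \<in> U" for x
    using Deriv.has_derivative_inverse[OF assms(3)[OF that] Ck_on_has_derivative[OF assms(1) Suc.prems that]]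
    by simp
  show ?case
    by (rule Ck_on_SucI[OF assms(1) der], assumption,
        intro bounded_bilinear.Ck_on[OF bounded_bilinear_mult assms(1)] Ck_on_const inv assms(1))
      (use Suc.prems in auto)
qed

context
  fixes U :: "'a::euclidean_space set"
  assumes opn: "open U"
begin

lemma smooth_on_cong: "smooth_on U f \<Longrightarrow> (\<And>x. x \<in> U \<Longrightarrow> f x = g x) \<Longrightarrow> smooth_on U g"
  unfolding smooth_on_def using Ck_on_cong[OF opn] by metis

lemma smooth_on_const: "smooth_on U (\<lambda>x. c)"
  by (simp add: smooth_on_def Ck_on_const opn)

lemma smooth_on_bounded_linear: "bounded_linear f \<Longrightarrow> smooth_on U f"
  by (simp add: smooth_on_def Ck_on_bounded_linear opn)

lemma smooth_on_add: "smooth_on U f \<Longrightarrow> smooth_on U g \<Longrightarrow> smooth_on U (\<lambda>x. f x + g x)"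
  by (simp add: smooth_on_def Ck_on_add opn)

lemma smooth_on_bilinear:
  "bounded_bilinear h \<Longrightarrow> smooth_on U f \<Longrightarrow> smooth_on U g \<Longrightarrow> smooth_on U (\<lambda>x. h (f x) (g x))"
  by (simp add: smooth_on_def bounded_bilinear.Ck_on opn)

lemma smooth_on_inverse:
  fixes f :: "'a \<Rightarrow> real"
  shows "smooth_on U f \<Longrightarrow> (\<And>x. x \<in> U \<Longrightarrow> f x \<noteq> 0) \<Longrightarrow> smooth_on U (\<lambda>x. inverse (f x))"
  by (simp add: smooth_on_def Ck_on_inverse opn)

lemma smooth_on_diff:
  assumes "smooth_on U f" "smooth_on U g" shows "smooth_on U (\<lambda>x. f x - g x)"
  using smooth_on_add[OF assms(1) smooth_on_bilinear[OF bounded_bilinear_scaleR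
    smooth_on_const[of "- 1"] assms(2)]] by simp

lemma smooth_on_sum:
  assumes "finite I" "\<And>i. i \<in> I \<Longrightarrow> smooth_on U (f i)"
  shows "smooth_on U (\<lambda>x. \<Sum>i\<in>I. f i x)"
  using assms by (induction I rule: finite_induct) (auto intro: smooth_on_const smooth_on_add)

lemma smooth_on_has_derivative:
  "smooth_on U f \<Longrightarrow> x \<in> U \<Longrightarrow> (f has_derivative frechet_derivative f (at x)) (at x)"
  unfolding smooth_on_def using Ck_on_has_derivative[OF opn] by metis

lemma smooth_on_derivative: "smooth_on U f \<Longrightarrow> smooth_on U (\<lambda>x. frechet_derivative f (at x) v)"
  unfolding smooth_on_def using Ck_on.simps(2) by metis

lemma frechet_derivative_expand:
  assumes "smooth_on U f" "x \<in> U"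
  shows "frechet_derivative f (at x) v = (\<Sum>b\<in>Basis. (v \<bullet> b) *\<^sub>R frechet_derivative f (at x) b)"
proof -
  interpret bounded_linear "frechet_derivative f (at x)"
    using smooth_on_has_derivative[OF assms] by (rule has_derivative_bounded_linear)
  show ?thesis
    by (metis (no_types, lifting) euclidean_representation scaleR sum sum.cong)
qed

text \<open>Smoothness of \<open>f\<close> speaks about derivatives in constant directions; expanding the field in a
  basis reduces a variable direction to these.\<close>

lemma smooth_on_deriv_along:
  assumes "smooth_on U X" "smooth_on U f"
  shows "smooth_on U (deriv_along X f)"
proof (rule smooth_on_cong)
  show "smooth_on U (\<lambda>x. \<Sum>b\<in>Basis. (X x \<bullet> b) *\<^sub>R frechet_derivative f (at x) b)"
    by (intro smooth_on_sum smooth_on_bilinear[OF bounded_bilinear_scaleR]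
        smooth_on_bilinear[OF bounded_bilinear_inner] smooth_on_derivative smooth_on_const assms finite_Basis)
qed (simp add: deriv_along_def flip: frechet_derivative_expand[OF assms(2)])

lemma smooth_on_lie_bracket:
  assumes "smooth_on U X" "smooth_on U Y"
  shows "smooth_on U (lie_bracket X Y)"
  using smooth_on_diff[OF smooth_on_deriv_along[OF assms] smooth_on_deriv_along[OF assms(2,1)]]
  by (simp add: lie_bracket_def[abs_def])

end

lemma deriv_along_eq: "(f has_derivative f') (at p) \<Longrightarrow> deriv_along X f p = f' (X p)"
  by (simp add: deriv_along_def flip: frechet_derivative_at)

section \<open>Symmetry of second derivatives\<close>

text \<open>The mean value theorem, applied to \<open>s \<mapsto> f (p + s u + h v) - f (p + s u)\<close> and then to the
  derivative of \<open>f\<close> along \<open>u\<close> on a segment in direction \<open>v\<close>.  The second difference on the left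
  is symmetric in \<open>u\<close> and \<open>v\<close>.\<close>

lemma second_difference_mean_value:
  fixes f :: "'a::euclidean_space \<Rightarrow> real"
  assumes "open U" "smooth_on U f" "0 < h"
    and box: "\<And>s t. 0 \<le> s \<Longrightarrow> s \<le> h \<Longrightarrow> 0 \<le> t \<Longrightarrow> t \<le> h \<Longrightarrow> p + s *\<^sub>R u + t *\<^sub>R v \<in> U"
  obtains s t where "0 < s" "s < h" "0 < t" "t < h"
    and "f (p + h *\<^sub>R u + h *\<^sub>R v) - f (p + h *\<^sub>R u) - f (p + h *\<^sub>R v) + f p =
      h * h * frechet_derivative (\<lambda>x. frechet_derivative f (at x) u) (at (p + s *\<^sub>R u + t *\<^sub>R v)) v"
proof -
  define F where "F = (\<lambda>x. frechet_derivative f (at x) u)"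
  note der = smooth_on_has_derivative[OF assms(1)]
  have F: "smooth_on U F"
    unfolding F_def by (rule smooth_on_derivative[OF assms(1,2)])
  have line: "((\<lambda>s. k (x + s *\<^sub>R w)) has_real_derivative frechet_derivative k (at (x + s *\<^sub>R w)) w) (at s)"
    if "smooth_on U k" "x + s *\<^sub>R w \<in> U" for k :: "'a \<Rightarrow> real" and x w s
  proof -
    have "((\<lambda>s. x + s *\<^sub>R w) has_derivative (\<lambda>t. t *\<^sub>R w)) (at s)"
      by (auto intro!: derivative_eq_intros)
    from has_derivative_compose[OF this der[OF that]]
    have "((\<lambda>s. k (x + s *\<^sub>R w)) has_derivative
        (\<lambda>t. frechet_derivative k (at (x + s *\<^sub>R w)) (t *\<^sub>R w))) (at s)" .
    moreover have "frechet_derivative k (at (x + s *\<^sub>R w)) (t *\<^sub>R w) =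
        frechet_derivative k (at (x + s *\<^sub>R w)) w * t" for t
      using has_derivative_bounded_linear[OF der[OF that]] by (simp add: bounded_linear.axioms(1) linear_scale)
    ultimately show ?thesis by (simp add: has_field_derivative_def)
  qed
  have "\<exists>s. 0 < s \<and> s < h \<and>
      (f ((p + h *\<^sub>R v) + h *\<^sub>R u) - f (p + h *\<^sub>R u)) - (f ((p + h *\<^sub>R v) + 0 *\<^sub>R u) - f (p + 0 *\<^sub>R u)) =
      (h - 0) * (F ((p + h *\<^sub>R v) + s *\<^sub>R u) - F (p + s *\<^sub>R u))"
    unfolding F_def
    using box[of _ h] box[of _ 0] \<open>0 < h\<close>
    by (intro MVT2 DERIV_diff line[OF assms(2)]) (auto simp: algebra_simps)
  then obtain s where s: "0 < s" "s < h" and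
    es: "f ((p + h *\<^sub>R v) + h *\<^sub>R u) - f (p + h *\<^sub>R u) - (f (p + h *\<^sub>R v) - f p) =
      h * (F ((p + h *\<^sub>R v) + s *\<^sub>R u) - F (p + s *\<^sub>R u))"
    by auto
  have "\<exists>t. 0 < t \<and> t < h \<and>
      F ((p + s *\<^sub>R u) + h *\<^sub>R v) - F ((p + s *\<^sub>R u) + 0 *\<^sub>R v) =
      (h - 0) * frechet_derivative F (at ((p + s *\<^sub>R u) + t *\<^sub>R v)) v"
    using box[of s] s \<open>0 < h\<close> by (intro MVT2 line[OF F]) auto
  then obtain t where t: "0 < t" "t < h" and
    et: "F ((p + s *\<^sub>R u) + h *\<^sub>R v) - F (p + s *\<^sub>R u) =
      h * frechet_derivative F (at (p + s *\<^sub>R u + t *\<^sub>R v)) v"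
    by auto
  show thesis
    using that[OF s t] es et unfolding F_def[symmetric] by (simp add: algebra_simps)
qed

text \<open>The same second difference equals \<open>h\<^sup>2\<close> times either mixed derivative at points that tend to
  \<open>p\<close> with \<open>h\<close>; the mixed derivatives are continuous, so they agree at \<open>p\<close>.\<close>

lemma second_derivative_symmetric_real:
  fixes f :: "'a::euclidean_space \<Rightarrow> real"
  assumes "open U" "smooth_on U f" "p \<in> U"
  shows "frechet_derivative (\<lambda>x. frechet_derivative f (at x) u) (at p) v =
    frechet_derivative (\<lambda>x. frechet_derivative f (at x) v) (at p) u"
proof -
  define D where "D = (\<lambda>u v x. frechet_derivative (\<lambda>x. frechet_derivative f (at x) u) (at x) v)"
  have cont: "isCont (D u v) p" for u v
  proof -
    have "smooth_on U (D u v)"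
      unfolding D_def using assms by (intro smooth_on_derivative)
    then show ?thesis
      using assms by (metis has_derivative_continuous smooth_on_has_derivative)
  qed
  have "\<bar>D u v p - D v u p\<bar> \<le> e" if "0 < e" for e
  proof -
    have "eventually (\<lambda>x. \<bar>D w z x - D w z p\<bar> < e / 2) (nhds p)" for w z
      using tendstoD[OF cont[of w z, unfolded isCont_def], of "e / 2"] that
      by (auto simp: eventually_at_filter dist_real_def elim!: eventually_mono)
    then have "eventually (\<lambda>x. x \<in> U \<and> \<bar>D u v x - D u v p\<bar> < e / 2 \<and> \<bar>D v u x - D v u p\<bar> < e / 2) (nhds p)"
      using assms by (auto intro!: eventually_conj eventually_nhds_in_open)
    then obtain r where r: "0 < r" and
      near: "\<And>x. dist x p < r \<Longrightarrow> x \<in> U \<and> \<bar>D u v x - D u v p\<bar> < e / 2 \<and> \<bar>D v u x - D v u p\<bar> < e / 2"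
      by (auto simp: eventually_nhds_metric)
    \<comment> \<open>so small that the whole parallelogram spanned by \<open>h u\<close> and \<open>h v\<close> at \<open>p\<close> stays in the ball of
      radius \<open>r\<close>; the summand 1 covers \<open>u = v = 0\<close>\<close>
    define h where "h = r / (norm u + norm v + 1)"
    have den: "0 < norm u + norm v + 1" by (simp add: add_nonneg_pos)
    have h: "0 < h" using r den by (simp add: h_def)
    have close: "dist (p + s *\<^sub>R u + t *\<^sub>R v) p < r" if "0 \<le> s" "s \<le> h" "0 \<le> t" "t \<le> h" for s t
    proof -
      have "dist (p + s *\<^sub>R u + t *\<^sub>R v) p = norm (s *\<^sub>R u + t *\<^sub>R v)"
        by (simp add: dist_norm)
      also have "\<dots> \<le> s * norm u + t * norm v"
        using norm_triangle_ineq[of "s *\<^sub>R u" "t *\<^sub>R v"] that by simp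
      also have "\<dots> \<le> h * norm u + h * norm v"
        using that by (intro add_mono mult_right_mono) auto
      also have "\<dots> < h * (norm u + norm v + 1)" using h by (simp add: algebra_simps)
      also have "\<dots> = r" using den by (simp add: h_def)
      finally show ?thesis .
    qed
    have box: "p + s *\<^sub>R u + t *\<^sub>R v \<in> U" if "0 \<le> s" "s \<le> h" "0 \<le> t" "t \<le> h" for s t
      using near close that by blast
    then have box': "p + s *\<^sub>R v + t *\<^sub>R u \<in> U" if "0 \<le> s" "s \<le> h" "0 \<le> t" "t \<le> h" for s t
      using that by (metis add.assoc add.commute)
    obtain s t where st: "0 < s" "s < h" "0 < t" "t < h"
      and e1: "f (p + h *\<^sub>R u + h *\<^sub>R v) - f (p + h *\<^sub>R u) - f (p + h *\<^sub>R v) + f p =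
        h * h * D u v (p + s *\<^sub>R u + t *\<^sub>R v)"
      unfolding D_def by (rule second_difference_mean_value[OF assms(1,2) h box])
    obtain s' t' where st': "0 < s'" "s' < h" "0 < t'" "t' < h"
      and e2: "f (p + h *\<^sub>R v + h *\<^sub>R u) - f (p + h *\<^sub>R v) - f (p + h *\<^sub>R u) + f p =
        h * h * D v u (p + s' *\<^sub>R v + t' *\<^sub>R u)"
      unfolding D_def by (rule second_difference_mean_value[OF assms(1,2) h box'])
    have "p + s' *\<^sub>R v + t' *\<^sub>R u = p + t' *\<^sub>R u + s' *\<^sub>R v"
      "p + h *\<^sub>R v + h *\<^sub>R u = p + h *\<^sub>R u + h *\<^sub>R v" by simp_all
    with e1 e2 have "h * h * D u v (p + s *\<^sub>R u + t *\<^sub>R v) = h * h * D v u (p + t' *\<^sub>R u + s' *\<^sub>R v)"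
      by (simp only:)
    with h have "D u v (p + s *\<^sub>R u + t *\<^sub>R v) = D v u (p + t' *\<^sub>R u + s' *\<^sub>R v)" by simp
    moreover have "\<bar>D u v (p + s *\<^sub>R u + t *\<^sub>R v) - D u v p\<bar> < e / 2"
      using near[OF close[of s t]] st by auto
    moreover have "\<bar>D v u (p + t' *\<^sub>R u + s' *\<^sub>R v) - D v u p\<bar> < e / 2"
      using near[OF close[of t' s']] st' by auto
    ultimately show ?thesis by linarith
  qed
  then have "\<bar>D u v p - D v u p\<bar> \<le> 0" by (rule field_le_epsilon) simp
  then show ?thesis by (simp add: D_def)
qed

lemma second_derivative_symmetric:
  fixes f :: "'a::euclidean_space \<Rightarrow> 'b::euclidean_space"
  assumes "open U" "smooth_on U f" "p \<in> U"
  shows "frechet_derivative (\<lambda>x. frechet_derivative f (at x) u) (at p) v =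
    frechet_derivative (\<lambda>x. frechet_derivative f (at x) v) (at p) u"
proof (rule euclidean_eqI)
  fix b :: 'b assume "b \<in> Basis"
  have comp: "frechet_derivative (\<lambda>x. k x \<bullet> b) (at x) w = frechet_derivative k (at x) w \<bullet> b"
    if "smooth_on U k" "x \<in> U" for k :: "'a \<Rightarrow> 'b" and x w
    using frechet_derivative_at[OF has_derivative_inner_left[OF smooth_on_has_derivative[OF assms(1) that]], of b]
    by metis
  have sm: "smooth_on U (\<lambda>x. f x \<bullet> b)"
    by (intro smooth_on_bilinear[OF assms(1) bounded_bilinear_inner] smooth_on_const assms)
  have "frechet_derivative (\<lambda>x. frechet_derivative f (at x) u) (at p) v \<bullet> b =
      frechet_derivative (\<lambda>x. frechet_derivative (\<lambda>x. f x \<bullet> b) (at x) u) (at p) v" for u v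
  proof -
    have F: "smooth_on U (\<lambda>x. frechet_derivative f (at x) u)"
      using assms by (intro smooth_on_derivative)
    have "((\<lambda>x. frechet_derivative (\<lambda>x. f x \<bullet> b) (at x) u) has_derivative
        (\<lambda>v. frechet_derivative (\<lambda>x. frechet_derivative f (at x) u) (at p) v \<bullet> b)) (at p)"
      by (rule has_derivative_transform_within_open[OF
            has_derivative_inner_left[OF smooth_on_has_derivative[OF assms(1) F assms(3)]] assms(1,3)])
        (simp add: comp[OF assms(2)])
    from frechet_derivative_at[OF this] show ?thesis by metis
  qed
  then show "frechet_derivative (\<lambda>x. frechet_derivative f (at x) u) (at p) v \<bullet> b =
      frechet_derivative (\<lambda>x. frechet_derivative f (at x) v) (at p) u \<bullet> b"
    using second_derivative_symmetric_real[OF assms(1) sm assms(3)] by simp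
qed

text \<open>The product rule for \<open>x \<mapsto> f'(x)(Y x)\<close>.  It is proved on the basis expansion of \<open>Y\<close>; two
  applications of symmetry let linearity be used only in the outer direction of the second
  derivative, where it is available.\<close>

lemma deriv_along_deriv_along:
  fixes f :: "'a::euclidean_space \<Rightarrow> 'b::euclidean_space"
  assumes "open U" "smooth_on U Y" "smooth_on U f" "p \<in> U"
  shows "deriv_along X (deriv_along Y f) p =
    frechet_derivative (\<lambda>x. frechet_derivative f (at x) (Y p)) (at p) (X p) +
    frechet_derivative f (at p) (deriv_along X Y p)"
proof -
  note der = smooth_on_has_derivative[OF assms(1)]
  have F: "smooth_on U (\<lambda>x. frechet_derivative f (at x) u)" for u
    using assms by (intro smooth_on_derivative)
  note expand = frechet_derivative_expand[OF assms(1) _ assms(4)]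
  have "((\<lambda>x. \<Sum>b\<in>Basis. (Y x \<bullet> b) *\<^sub>R frechet_derivative f (at x) b) has_derivative
     (\<lambda>h. \<Sum>b\<in>Basis. (Y p \<bullet> b) *\<^sub>R frechet_derivative (\<lambda>x. frechet_derivative f (at x) b) (at p) h
        + (frechet_derivative Y (at p) h \<bullet> b) *\<^sub>R frechet_derivative f (at p) b)) (at p)"
    by (intro has_derivative_sum has_derivative_scaleR has_derivative_inner_left der assms F)
  then have "(deriv_along Y f has_derivative
     (\<lambda>h. \<Sum>b\<in>Basis. (Y p \<bullet> b) *\<^sub>R frechet_derivative (\<lambda>x. frechet_derivative f (at x) b) (at p) h
        + (frechet_derivative Y (at p) h \<bullet> b) *\<^sub>R frechet_derivative f (at p) b)) (at p)"
    by (rule has_derivative_transform_within_open[OF _ assms(1,4)])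
      (simp add: deriv_along_def flip: frechet_derivative_expand[OF assms(1,3)])
  from deriv_along_eq[OF this, of X]
  have "deriv_along X (deriv_along Y f) p =
      (\<Sum>b\<in>Basis. (Y p \<bullet> b) *\<^sub>R frechet_derivative (\<lambda>x. frechet_derivative f (at x) b) (at p) (X p))
      + frechet_derivative f (at p) (deriv_along X Y p)"
    by (simp add: sum.distrib deriv_along_def[of X Y] flip: expand[OF assms(3)])
  also have "(\<Sum>b\<in>Basis. (Y p \<bullet> b) *\<^sub>R frechet_derivative (\<lambda>x. frechet_derivative f (at x) b) (at p) (X p)) =
     frechet_derivative (\<lambda>x. frechet_derivative f (at x) (X p)) (at p) (Y p)"
    by (subst expand[OF F]) (simp add: second_derivative_symmetric[OF assms(1,3,4), of _ "X p"])
  also have "\<dots> = frechet_derivative (\<lambda>x. frechet_derivative f (at x) (Y p)) (at p) (X p)"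
    by (rule second_derivative_symmetric[OF assms(1,3,4)])
  finally show ?thesis .
qed

text \<open>This makes the second derivatives cancel in the curvature.\<close>

lemma deriv_along_lie_bracket:
  fixes f :: "'a::euclidean_space \<Rightarrow> 'b::euclidean_space"
  assumes "open U" "smooth_on U X" "smooth_on U Y" "smooth_on U f" "p \<in> U"
  shows "deriv_along (lie_bracket X Y) f p =
    deriv_along X (deriv_along Y f) p - deriv_along Y (deriv_along X f) p"
proof -
  have "linear (frechet_derivative f (at p))"
    using smooth_on_has_derivative[OF assms(1,4,5)] has_derivative_linear by blast
  then have "deriv_along (lie_bracket X Y) f p = frechet_derivative f (at p) (deriv_along X Y p)
      - frechet_derivative f (at p) (deriv_along Y X p)"
    by (simp add: deriv_along_def[of "lie_bracket X Y"] lie_bracket_def linear_diff)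
  then show ?thesis
    using deriv_along_deriv_along[OF assms(1,3,4,5), of X] deriv_along_deriv_along[OF assms(1,2,4,5), of Y]
      second_derivative_symmetric[OF assms(1,4,5), of "X p" "Y p"] by simp
qed

section \<open>Uniqueness of the Levi-Civita connection\<close>

lemma polar_sym: "polar q v w = polar q w v"
  by (simp add: polar_def add.commute)

lemma levi_civita_metric:
  assumes "is_levi_civita U g D" "vector_field U X" "vector_field U Y" "vector_field U Z" "p \<in> U"
  shows "deriv_along X (\<lambda>r. polar (g r) (Y r) (Z r)) p =
    polar (g p) (D X Y p) (Z p) + polar (g p) (Y p) (D X Z p)"
  using assms by (simp add: is_levi_civita_def)

text \<open>The difference \<open>T\<close> of two Levi-Civita connections is symmetric, \<open>T(X, Y) = T(Y, X)\<close>, and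
  \<open>\<langle>T(X, Y), Z\<rangle>\<close> is skew in \<open>Y, Z\<close>.  A trilinear expression that is symmetric in the first two and
  skew in the last two arguments vanishes, because alternating the two exchanges brings back the
  original order after six steps with the sign \<open>-1\<close>.\<close>

lemma levi_civita_unique:
  assumes "open U" "is_levi_civita U g D" "is_levi_civita U g D'"
    and "quadratic_form (g p)" "nondegenerate_form (g p)"
    and "vector_field U X" "vector_field U Y" "p \<in> U"
  shows "D X Y p = D' X Y p"
proof -
  define T where "T = (\<lambda>X Y. D X Y p - D' X Y p)"
  define C where "C = (\<lambda>X Y Z. polar (g p) (T X Y) (Z p))"
  have bil: "bilinear (polar (g p))" using assms(4) by (simp add: quadratic_form_def)
  have symm: "C X Y Z = C Y X Z" if "vector_field U X" "vector_field U Y" for X Y Z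
  proof -
    have "D X Y p - D Y X p = D' X Y p - D' Y X p"
      using assms(2,3,8) that by (simp add: is_levi_civita_def)
    then have "T X Y = T Y X" by (simp add: T_def algebra_simps)
    then show ?thesis by (simp add: C_def)
  qed
  have skew: "C X Y Z = - C X Z Y" if "vector_field U X" "vector_field U Y" "vector_field U Z" for X Y Z
  proof -
    have "polar (g p) (D X Y p) (Z p) + polar (g p) (Y p) (D X Z p) =
        polar (g p) (D' X Y p) (Z p) + polar (g p) (Y p) (D' X Z p)"
      by (rule trans[OF levi_civita_metric[OF assms(2) that assms(8), symmetric]
            levi_civita_metric[OF assms(3) that assms(8)]])
    then have "polar (g p) (T X Y) (Z p) = - polar (g p) (Y p) (T X Z)"
      by (simp add: T_def bilinear_lsub[OF bil] bilinear_rsub[OF bil])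
    then show ?thesis by (simp add: C_def polar_sym[of "g p" "Y p" "T X Z"])
  qed
  have "polar (g p) (T X Y) w = 0" for w
  proof -
    have W: "vector_field U (\<lambda>_. w)" by (rule smooth_on_const[OF assms(1)])
    have "C X Y (\<lambda>_. w) = - C X Y (\<lambda>_. w)"
      using symm skew W assms(6,7) by metis
    then show ?thesis by (simp add: C_def)
  qed
  then have "T X Y = 0" using assms(5) by (simp add: nondegenerate_form_def)
  then show ?thesis by (simp add: T_def)
qed

section \<open>The half-space model\<close>

text \<open>The vector \<open>n\<close> represents the linear form that defines the half-space.  The form \<open>q\<close> may have
  any signature, and \<open>n\<close> may be isotropic, in which case the metric turns out flat.\<close>

locale half_space_model =
  fixes q :: "'a::euclidean_space \<Rightarrow> real" and n :: 'a
  assumes quadratic: "quadratic_form q" and nondegenerate: "nondegenerate_form q"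
begin

abbreviation height :: "'a \<Rightarrow> real" where "height \<equiv> polar q n"

definition half_space :: "'a set" where "half_space = {p. 0 < height p}"

definition metric :: "'a \<Rightarrow> 'a \<Rightarrow> real" where "metric p v = q v / (height p)\<^sup>2"

text \<open>For a conformal change \<open>e\<^bsup>2f\<^esup> q\<close> of a flat metric the connection form is
  \<open>df(v) w + df(w) v - \<langle>v, w\<rangle> grad f\<close>.  Here \<open>f = - ln height\<close>, and the factor \<open>1 / height\<close> of
  \<open>df\<close> and \<open>grad f\<close> is split off, so that the remaining map does not depend on the point.\<close>

definition christoffel :: "'a \<Rightarrow> 'a \<Rightarrow> 'a" where
  "christoffel v w = polar q v w *\<^sub>R n - height v *\<^sub>R w - height w *\<^sub>R v"

definition connection :: "('a \<Rightarrow> 'a) \<Rightarrow> ('a \<Rightarrow> 'a) \<Rightarrow> 'a \<Rightarrow> 'a" where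
  "connection X Y p = deriv_along X Y p + inverse (height p) *\<^sub>R christoffel (X p) (Y p)"

lemma bilinear_polar: "bilinear (polar q)"
  using quadratic by (simp add: quadratic_form_def)

lemma bounded_bilinear_polar: "bounded_bilinear (polar q)"
  using bilinear_polar by (simp add: bilinear_conv_bounded_bilinear)

lemmas polar_simps =
  bilinear_ladd[OF bilinear_polar] bilinear_radd[OF bilinear_polar]
  bilinear_lsub[OF bilinear_polar] bilinear_rsub[OF bilinear_polar]
  bilinear_lmul[OF bilinear_polar] bilinear_rmul[OF bilinear_polar]

lemma polar_self: "polar q v v = q v"
proof -
  have "q (2 *\<^sub>R v) = 2\<^sup>2 * q v" using quadratic unfolding quadratic_form_def by blast
  then show ?thesis by (simp add: polar_def scaleR_2)
qed

lemma bounded_linear_height: "bounded_linear height"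
  using bounded_bilinear.bounded_linear_right[OF bounded_bilinear_polar] .

lemma open_half_space: "open half_space"
  unfolding half_space_def
  by (intro open_Collect_less continuous_on_const linear_continuous_on bounded_linear_height)

lemma height_pos: "p \<in> half_space \<Longrightarrow> 0 < height p"
  by (simp add: half_space_def)

lemma polar_metric: "polar (metric p) v w = polar q v w / (height p)\<^sup>2"
  by (simp add: polar_def metric_def diff_divide_distrib add_divide_distrib)

lemma quadratic_metric: "quadratic_form (metric p)"
  using quadratic
  by (auto simp: quadratic_form_def polar_metric[abs_def] bilinear_def linear_iff metric_def
      add_divide_distrib)

lemma nondegenerate_metric: "p \<in> half_space \<Longrightarrow> nondegenerate_form (metric p)"
  using nondegenerate height_pos[of p]
  by (auto simp: nondegenerate_form_def polar_metric)

lemma christoffel_sym: "christoffel v w = christoffel w v"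
  by (simp add: christoffel_def polar_sym[of q v w])

lemma bilinear_christoffel: "bilinear christoffel"
  by (auto simp: bilinear_def linear_iff christoffel_def polar_simps algebra_simps)

lemmas christoffel_simps =
  bilinear_ladd[OF bilinear_christoffel] bilinear_radd[OF bilinear_christoffel]
  bilinear_lsub[OF bilinear_christoffel] bilinear_rsub[OF bilinear_christoffel]
  bilinear_lmul[OF bilinear_christoffel] bilinear_rmul[OF bilinear_christoffel]

lemma bounded_bilinear_christoffel: "bounded_bilinear christoffel"
  using bilinear_christoffel by (simp add: bilinear_conv_bounded_bilinear)

lemmas has_derivative_field = smooth_on_has_derivative[OF open_half_space]

lemma smooth_inverse_height: "smooth_on half_space (\<lambda>p. inverse (height p))"
  using height_pos
  by (intro smooth_on_inverse smooth_on_bounded_linear bounded_linear_height open_half_space) fastforce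

lemma smooth_connection:
  assumes "vector_field half_space X" "vector_field half_space Y"
  shows "vector_field half_space (connection X Y)"
  unfolding connection_def[abs_def]
  by (intro smooth_on_add smooth_on_deriv_along smooth_on_bilinear[OF _ bounded_bilinear_scaleR]
      smooth_on_bilinear[OF _ bounded_bilinear_christoffel] smooth_inverse_height open_half_space assms)

lemma connection_on_connection: "connection_on half_space connection"
  unfolding connection_on_def
proof (intro conjI allI impI ballI)
  fix X Y Z :: "'a \<Rightarrow> 'a" and p
  assume *: "vector_field half_space X" "vector_field half_space Y" "vector_field half_space Z"
    "p \<in> half_space"
  have "linear (frechet_derivative Z (at p))"
    using has_derivative_field[OF *(3,4)] has_derivative_linear by blast
  then show "connection (\<lambda>r. X r + Y r) Z p = connection X Z p + connection Y Z p"
    by (simp add: connection_def deriv_along_def linear_add christoffel_simps algebra_simps)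
  show "connection X (\<lambda>r. Y r + Z r) p = connection X Y p + connection X Z p"
    using deriv_along_eq[OF has_derivative_add[OF has_derivative_field[OF *(2,4)] has_derivative_field[OF *(3,4)]], of X]
    by (simp add: connection_def christoffel_simps algebra_simps deriv_along_def)
next
  fix f :: "'a \<Rightarrow> real" and X Y :: "'a \<Rightarrow> 'a" and p
  assume *: "smooth_on half_space f" "vector_field half_space X" "vector_field half_space Y"
    "p \<in> half_space"
  have "linear (frechet_derivative Y (at p))"
    using has_derivative_field[OF *(3,4)] has_derivative_linear by blast
  then show "connection (\<lambda>r. f r *\<^sub>R X r) Y p = f p *\<^sub>R connection X Y p"
    by (simp add: connection_def deriv_along_def linear_scale christoffel_simps algebra_simps)
  show "connection X (\<lambda>r. f r *\<^sub>R Y r) p = deriv_along X f p *\<^sub>R Y p + f p *\<^sub>R connection X Y p"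
    using deriv_along_eq[OF has_derivative_scaleR[OF has_derivative_field[OF *(1,4)] has_derivative_field[OF *(3,4)]], of X]
    by (simp add: connection_def christoffel_simps algebra_simps deriv_along_def)
qed (rule smooth_connection)

text \<open>The defect of \<open>christoffel\<close> from being skew for \<open>q\<close> is what compensates the derivative of the
  conformal factor \<open>1 / height\<^sup>2\<close>.\<close>

lemma christoffel_metric:
  "polar q (christoffel x y) z + polar q y (christoffel x z) = - (2 * height x * polar q y z)"
  by (simp add: christoffel_def polar_simps polar_sym[of q x n] polar_sym[of q y n] polar_sym[of q z n]
      polar_sym[of q y x] polar_sym[of q z x])

text \<open>The first two terms come from differentiating \<open>1 / height\<close>, the last two from iterating the
  connection.  All terms containing \<open>height\<close> of an argument, or the vector \<open>n\<close>, are symmetric in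
  \<open>x, y\<close> and cancel; only \<open>height n = q n\<close> survives.\<close>

lemma christoffel_curvature:
  "height x *\<^sub>R christoffel y z - height y *\<^sub>R christoffel x z
     - christoffel x (christoffel y z) + christoffel y (christoffel x z) =
   q n *\<^sub>R (polar q y z *\<^sub>R x - polar q x z *\<^sub>R y)"
  by (simp add: christoffel_def polar_simps polar_self polar_sym[of q x n] polar_sym[of q y n] polar_sym[of q z n]
      polar_sym[of q y x] algebra_simps) (simp only: mult_2 scaleR_left_distrib ac_simps)

lemma deriv_along_connection:
  assumes "vector_field half_space Y" "vector_field half_space Z" "p \<in> half_space"
  shows "deriv_along X (connection Y Z) p = deriv_along X (deriv_along Y Z) p
    + inverse (height p) *\<^sub>R
        (christoffel (deriv_along X Y p) (Z p) + christoffel (Y p) (deriv_along X Z p))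
    - (height (X p) * (inverse (height p))\<^sup>2) *\<^sub>R christoffel (Y p) (Z p)"
proof -
  let ?i = "inverse (height p)"
  have i: "((\<lambda>r. inverse (height r)) has_derivative (\<lambda>v. - (?i * height v * ?i))) (at p)"
    using height_pos[OF assms(3)]
    by (intro Deriv.has_derivative_inverse bounded_linear_imp_has_derivative bounded_linear_height) simp
  have "(connection Y Z has_derivative (\<lambda>v. frechet_derivative (deriv_along Y Z) (at p) v +
      (?i *\<^sub>R (christoffel (Y p) (frechet_derivative Z (at p) v)
              + christoffel (frechet_derivative Y (at p) v) (Z p))
       + (- (?i * height v * ?i)) *\<^sub>R christoffel (Y p) (Z p)))) (at p)"
    unfolding connection_def[abs_def]
    by (rule has_derivative_add[OF has_derivative_field[OF smooth_on_deriv_along[OF open_half_space assms(1,2)] assms(3)]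
          has_derivative_scaleR[OF i bounded_bilinear.FDERIV[OF bounded_bilinear_christoffel
            has_derivative_field[OF assms(1,3)] has_derivative_field[OF assms(2,3)]]]])
  from deriv_along_eq[OF this, of X] show ?thesis
    by (simp add: deriv_along_def[of X "deriv_along Y Z"] deriv_along_def[of X Y] deriv_along_def[of X Z]
        power2_eq_square algebra_simps)
qed

lemma deriv_along_cong:
  assumes "\<And>r. r \<in> half_space \<Longrightarrow> h r = k r" "vector_field half_space k" "p \<in> half_space"
  shows "deriv_along X h p = deriv_along X k p"
  by (rule deriv_along_eq[OF has_derivative_transform_within_open[OF has_derivative_field[OF assms(2,3)]
          open_half_space assms(3)], THEN trans])
    (simp_all add: assms(1) deriv_along_def)

text \<open>A structure on the half-space is given only up to its values outside.\<close>

context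
  fixes g :: "'a \<Rightarrow> 'a \<Rightarrow> real"
  assumes g: "\<And>p. p \<in> half_space \<Longrightarrow> g p = metric p"
begin

lemma metric_compatible:
  assumes "vector_field half_space X" "vector_field half_space Y" "vector_field half_space Z"
    and p: "p \<in> half_space"
  shows "deriv_along X (\<lambda>r. polar (g r) (Y r) (Z r)) p =
    polar (g p) (connection X Y p) (Z p) + polar (g p) (Y p) (connection X Z p)"
proof -
  let ?i = "inverse (height p)"
  have i: "((\<lambda>r. inverse (height r)) has_derivative (\<lambda>v. - (?i * height v * ?i))) (at p)"
    using height_pos[OF p]
    by (intro Deriv.has_derivative_inverse bounded_linear_imp_has_derivative bounded_linear_height) simp
  have "((\<lambda>r. (inverse (height r) * inverse (height r)) * polar q (Y r) (Z r)) has_derivative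
      (\<lambda>v. (?i * ?i) * (polar q (Y p) (frechet_derivative Z (at p) v) +
             polar q (frechet_derivative Y (at p) v) (Z p))
           + (?i * - (?i * height v * ?i) + - (?i * height v * ?i) * ?i) * polar q (Y p) (Z p))) (at p)"
    by (rule has_derivative_mult[OF has_derivative_mult[OF i i]
          bounded_bilinear.FDERIV[OF bounded_bilinear_polar
            has_derivative_field[OF assms(2) p] has_derivative_field[OF assms(3) p]]])
  then have "((\<lambda>r. polar (g r) (Y r) (Z r)) has_derivative
      (\<lambda>v. (?i * ?i) * (polar q (Y p) (frechet_derivative Z (at p) v) +
             polar q (frechet_derivative Y (at p) v) (Z p))
           + (?i * - (?i * height v * ?i) + - (?i * height v * ?i) * ?i) * polar q (Y p) (Z p))) (at p)"
    by (rule has_derivative_transform_within_open[OF _ open_half_space p])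
      (simp add: g polar_metric power2_eq_square divide_inverse)
  from deriv_along_eq[OF this, of X]
  have "deriv_along X (\<lambda>r. polar (g r) (Y r) (Z r)) p =
      ?i\<^sup>2 * (polar q (Y p) (deriv_along X Z p) + polar q (deriv_along X Y p) (Z p)
        + ?i * - (2 * height (X p) * polar q (Y p) (Z p)))"
    by (simp add: deriv_along_def[of X Y] deriv_along_def[of X Z] power2_eq_square algebra_simps)
  also have "\<dots> = polar (g p) (connection X Y p) (Z p) + polar (g p) (Y p) (connection X Z p)"
    by (simp add: g[OF p] polar_metric connection_def polar_simps divide_inverse power_inverse
        flip: christoffel_metric) (simp add: algebra_simps)
  finally show ?thesis .
qed

lemma is_levi_civita_connection: "is_levi_civita half_space g connection"
  unfolding is_levi_civita_def
  by (intro conjI connection_on_connection allI impI ballI metric_compatible)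
    (simp_all add: connection_def lie_bracket_def christoffel_sym)

lemma levi_civita_eq_connection:
  assumes "vector_field half_space X" "vector_field half_space Y" "p \<in> half_space"
  shows "levi_civita half_space g X Y p = connection X Y p"
proof (rule levi_civita_unique[OF open_half_space _ is_levi_civita_connection _ _ assms])
  show "is_levi_civita half_space g (levi_civita half_space g)"
    unfolding levi_civita_def
    by (rule someI[where P = "is_levi_civita half_space g", OF is_levi_civita_connection])
qed (simp_all add: g[OF assms(3)] quadratic_metric nondegenerate_metric[OF assms(3)])

lemma curvature_field_eq:
  assumes X: "vector_field half_space X" and Y: "vector_field half_space Y"
    and Z: "vector_field half_space Z" and p: "p \<in> half_space"
  shows "curvature_field (levi_civita half_space g) X Y Z p =
    (- q n) *\<^sub>R (polar (g p) (X p) (Z p) *\<^sub>R Y p - polar (g p) (Y p) (Z p) *\<^sub>R X p)"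
proof -
  let ?L = "levi_civita half_space g" and ?i = "inverse (height p)" and ?C = christoffel
  \<comment> \<open>The terms with a first derivative of \<open>Z\<close> are together symmetric in \<open>X, Y\<close>; the second
    derivative of \<open>Z\<close> and the derivative of \<open>Y\<close> are matched by the bracket term of the curvature.\<close>
  have second: "?L X (?L Y Z) p = deriv_along X (deriv_along Y Z) p
      + ?i *\<^sub>R (?C (deriv_along X Y p) (Z p) + ?C (Y p) (deriv_along X Z p) + ?C (X p) (deriv_along Y Z p))
      + ?i\<^sup>2 *\<^sub>R (?C (X p) (?C (Y p) (Z p)) - height (X p) *\<^sub>R ?C (Y p) (Z p))"
    if "vector_field half_space X" "vector_field half_space Y" for X Y
  proof -
    have smooth: "vector_field half_space (?L Y Z)"
      by (rule smooth_on_cong[OF open_half_space smooth_connection[OF that(2) Z]])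
        (simp add: levi_civita_eq_connection that Z)
    have "deriv_along X (?L Y Z) p = deriv_along X (connection Y Z) p"
      by (rule deriv_along_cong) (simp_all add: levi_civita_eq_connection smooth_connection that Z p)
    then show ?thesis
      by (simp add: levi_civita_eq_connection[OF that(1) smooth p] connection_def[of X "?L Y Z"]
          levi_civita_eq_connection[OF that(2) Z p] deriv_along_connection[OF that(2) Z p])
        (simp add: connection_def christoffel_simps power2_eq_square algebra_simps)
  qed
  have "?L (lie_bracket X Y) Z p = deriv_along X (deriv_along Y Z) p - deriv_along Y (deriv_along X Z) p
      + ?i *\<^sub>R (?C (deriv_along X Y p) (Z p) - ?C (deriv_along Y X p) (Z p))"
    by (simp add: levi_civita_eq_connection[OF smooth_on_lie_bracket[OF open_half_space X Y] Z p]
        connection_def deriv_along_lie_bracket[OF open_half_space X Y Z p] lie_bracket_def[of X Y p]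
        christoffel_simps)
  then have "curvature_field ?L X Y Z p =
      ?i\<^sup>2 *\<^sub>R (height (X p) *\<^sub>R ?C (Y p) (Z p) - height (Y p) *\<^sub>R ?C (X p) (Z p)
        - ?C (X p) (?C (Y p) (Z p)) + ?C (Y p) (?C (X p) (Z p)))"
    by (simp add: curvature_field_def second[OF X Y] second[OF Y X] algebra_simps)
  also have "\<dots> = ?i\<^sup>2 *\<^sub>R (q n *\<^sub>R (polar q (Y p) (Z p) *\<^sub>R X p - polar q (X p) (Z p) *\<^sub>R Y p))"
    by (simp only: christoffel_curvature)
  finally show ?thesis
    by (simp add: g[OF p] polar_metric divide_inverse power_inverse algebra_simps)
qed

text \<open>The curvature field depends only on the values of the fields at \<open>p\<close>, and constant fields show
  that every triple of tangent vectors extends.\<close>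

lemma curvature_tensor_eq:
  assumes "p \<in> half_space"
  shows "curvature_tensor half_space g p v w z =
    (- q n) *\<^sub>R (polar (g p) v z *\<^sub>R w - polar (g p) w z *\<^sub>R v)"
  unfolding curvature_tensor_def
proof (rule the_equality)
  fix r assume *: "\<forall>X Y Z. vector_field half_space X \<and> vector_field half_space Y \<and>
      vector_field half_space Z \<and> X p = v \<and> Y p = w \<and> Z p = z \<longrightarrow>
      curvature_field (levi_civita half_space g) X Y Z p = r"
  have const: "vector_field half_space (\<lambda>_. u)" for u
    by (rule smooth_on_const[OF open_half_space])
  have "curvature_field (levi_civita half_space g) (\<lambda>_. v) (\<lambda>_. w) (\<lambda>_. z) p = r"
    using * const by blast
  then show "r = (- q n) *\<^sub>R (polar (g p) v z *\<^sub>R w - polar (g p) w z *\<^sub>R v)"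
    using curvature_field_eq[OF const const const assms, of v w z] by simp
qed (auto simp: curvature_field_eq assms)

end
end

section \<open>Constant sectional curvature\<close>

lemma gram_Q_change_of_basis:
  assumes "quadratic_form q"
  shows "gram_Q q (\<alpha> *\<^sub>R v + \<beta> *\<^sub>R w) (\<gamma> *\<^sub>R v + \<delta> *\<^sub>R w) = (\<alpha> * \<delta> - \<beta> * \<gamma>)\<^sup>2 * gram_Q q v w"
proof -
  have bil: "bilinear (polar q)" using assms by (simp add: quadratic_form_def)
  show ?thesis
    by (simp add: gram_Q_def bilinear_ladd[OF bil] bilinear_radd[OF bil] bilinear_lmul[OF bil]
        bilinear_rmul[OF bil] polar_sym[of q w v]) algebra
qed

text \<open>Nondegeneracy of a plane is witnessed by one basis only; the square of the determinant of the
  base change transfers it to all, so that the quotient in the sectional curvature never has the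
  denominator 0.\<close>

lemma gram_Q_nonzero:
  assumes "quadratic_form q" "nondegenerate_plane q P" "plane_basis P v w"
  shows "gram_Q q v w \<noteq> 0"
proof -
  obtain v' w' where *: "plane_basis P v' w'" "gram_Q q v' w' \<noteq> 0"
    using assms(2) by (auto simp: nondegenerate_plane_def)
  have span: "span {v', w'} = span {v, w}"
    using *(1) assms(3) by (simp add: plane_basis_def)
  have combination: "\<exists>\<alpha> \<beta>. z = \<alpha> *\<^sub>R v + \<beta> *\<^sub>R w" if "z \<in> span {v, w}" for z
  proof -
    obtain \<alpha> where "z - \<alpha> *\<^sub>R v \<in> span {w}"
      using \<open>z \<in> span {v, w}\<close> span_breakdown_eq by blast
    then obtain \<beta> where "z - \<alpha> *\<^sub>R v = \<beta> *\<^sub>R w"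
      by (auto simp: span_singleton)
    then have "z = \<alpha> *\<^sub>R v + \<beta> *\<^sub>R w" by (simp add: diff_eq_eq add.commute)
    then show ?thesis by blast
  qed
  have "v' \<in> span {v, w}" "w' \<in> span {v, w}"
    by (simp_all add: span_base flip: span)
  then obtain \<alpha> \<beta> \<gamma> \<delta> where "v' = \<alpha> *\<^sub>R v + \<beta> *\<^sub>R w" "w' = \<gamma> *\<^sub>R v + \<delta> *\<^sub>R w"
    using combination by meson
  then show ?thesis
    using *(2) gram_Q_change_of_basis[OF assms(1), of \<alpha> v \<beta> w \<gamma> \<delta>] by auto
qed

lemma has_constant_curvatureI:
  assumes "\<And>p. p \<in> U \<Longrightarrow> quadratic_form (g p)"
    and R: "\<And>p v w. p \<in> U \<Longrightarrow> curvature_tensor U g p v w v =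
      K *\<^sub>R (polar (g p) v v *\<^sub>R w - polar (g p) w v *\<^sub>R v)"
  shows "has_constant_curvature U g K"
proof -
  have K: "polar (g p) (curvature_tensor U g p v w v) w / gram_Q (g p) v w = K"
    if p: "p \<in> U" and P: "nondegenerate_plane (g p) P" and b: "plane_basis P v w" for p P v w
  proof -
    have bil: "bilinear (polar (g p))" using assms(1)[OF p] by (simp add: quadratic_form_def)
    have "polar (g p) (curvature_tensor U g p v w v) w = K * gram_Q (g p) v w"
      by (simp add: R[OF p] bilinear_lmul[OF bil] bilinear_lsub[OF bil] gram_Q_def power2_eq_square
          polar_sym[of "g p" w v])
    then show ?thesis using gram_Q_nonzero[OF assms(1)[OF p] P b] by simp
  qed
  show ?thesis
    unfolding has_constant_curvature_def sectional_curvature_def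
  proof (intro ballI allI impI the_equality)
    fix p P k assume p: "p \<in> U" and P: "nondegenerate_plane (g p) P"
      and k: "\<forall>v w. plane_basis P v w \<longrightarrow>
        k = polar (g p) (curvature_tensor U g p v w v) w / gram_Q (g p) v w"
    obtain v w where "plane_basis P v w" using P by (auto simp: nondegenerate_plane_def)
    then show "k = K" using k K[OF p P] by metis
  qed (simp add: K)
qed

theorem (in half_space_model) half_space_constant_curvature:
  assumes "\<And>p. p \<in> half_space \<Longrightarrow> g p = metric p"
  shows "has_constant_curvature half_space g (- q n)"
  by (rule has_constant_curvatureI) (simp_all add: assms quadratic_metric curvature_tensor_eq)

section \<open>The affine group\<close>

text \<open>The Gram matrix of \<open>q\<close> has entries \<open>c\<^sup>2 - a\<^sup>2\<close>, \<open>c d - a b\<close>, \<open>d\<^sup>2 - b\<^sup>2\<close> and determinant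
  \<open>- (a d - b c)\<^sup>2\<close>; the vector \<open>n\<close> is the second column of its inverse.\<close>

lemma half_space_model_lorentz_plane:
  fixes a b c d :: real
  assumes "a * d - b * c \<noteq> 0"
  defines "q \<equiv> (\<lambda>v::real \<times> real. - (a * fst v + b * snd v)\<^sup>2 + (c * fst v + d * snd v)\<^sup>2)"
    and "n \<equiv> (1 / (a * d - b * c)\<^sup>2) *\<^sub>R (c * d - a * b, a\<^sup>2 - c\<^sup>2)"
  shows "half_space_model q" "polar q n v = snd v" "- q n = (c\<^sup>2 - a\<^sup>2) / (a * d - b * c)\<^sup>2"
proof -
  define B where "B = (\<lambda>v w::real \<times> real. - (a * fst v + b * snd v) * (a * fst w + b * snd w)
    + (c * fst v + d * snd v) * (c * fst w + d * snd w))"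
  have B: "polar q = B"
  proof (intro ext)
    fix v w
    have "q (v + w) - q v - q w = 2 * B v w"
      by (simp add: q_def B_def power2_eq_square algebra_simps)
    then show "polar q v w = B v w" by (simp add: polar_def)
  qed
  have quad: "quadratic_form q"
    unfolding quadratic_form_def B
    by (auto simp: bilinear_def linear_iff B_def q_def power2_eq_square algebra_simps)
  have dual: "B ((1 / (a * d - b * c)\<^sup>2) *\<^sub>R (c * d - a * b, a\<^sup>2 - c\<^sup>2)) v = snd v" for v
  proof -
    have "B ((c * d - a * b, a\<^sup>2 - c\<^sup>2)) v = (a * d - b * c)\<^sup>2 * snd v"
      unfolding B_def fst_conv snd_conv by algebra
    moreover have "bilinear B" using quad by (simp add: quadratic_form_def B)
    ultimately show ?thesis using assms(1) by (simp add: bilinear_lmul del: scaleR_Pair)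
  qed
  then show n: "polar q n v = snd v" by (simp add: B n_def)
  have "v = 0" if "\<forall>w. B v w = 0" for v
  proof -
    let ?s = "a * fst v + b * snd v" and ?t = "c * fst v + d * snd v"
    have e: "- ?s * a + ?t * c = 0" "- ?s * b + ?t * d = 0"
      using that[rule_format, of "(1, 0)"] that[rule_format, of "(0, 1)"] by (simp_all add: B_def)
    \<comment> \<open>\<open>(?s, ?t)\<close> is the image of \<open>v\<close> under the matrix with rows \<open>(a, b)\<close> and \<open>(c, d)\<close>; the
      transpose of this matrix kills \<open>(- ?s, ?t)\<close>\<close>
    have "(a * d - b * c) * ?s = 0" "(a * d - b * c) * ?t = 0" using e by algebra+
    with assms(1) have "?s = 0" "?t = 0" by auto
    moreover from this have "(a * d - b * c) * fst v = 0" "(a * d - b * c) * snd v = 0" by algebra+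
    ultimately show ?thesis using assms(1) by (simp add: prod_eq_iff)
  qed
  then show "half_space_model q"
    using quad by unfold_locales (auto simp: nondegenerate_form_def B)
  then have "q n = polar q n n" by (simp add: half_space_model.polar_self)
  also have "\<dots> = snd n" using dual by (simp add: B n_def)
  finally show "- q n = (c\<^sup>2 - a\<^sup>2) / (a * d - b * c)\<^sup>2"
    by (simp add: n_def diff_divide_distrib)
qed

theorem theorem4:
  fixes g :: "real \<times> real \<Rightarrow> real \<times> real \<Rightarrow> real"
    and a b c d :: real and A :: "real ^ 2 ^ 2"
  assumes "lorentzian_structure Aff g"
    and "left_invariant g"
    and "A = vector [vector [a, b], vector [c, d]]"
    and "det A > 0"
    and "\<forall>q\<in>Aff. \<forall>u1 u2. g q (u1 *\<^sub>R X1 q + u2 *\<^sub>R X2 q) =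
           - (a * u1 + b * u2)\<^sup>2 + (c * u1 + d * u2)\<^sup>2"
  shows "has_constant_curvature Aff g (g aff_id (X1 aff_id) / (det A)\<^sup>2) \<and>
    (\<forall>q\<in>Aff. g q (X1 q) = c\<^sup>2 - a\<^sup>2)"
proof
  have det: "det A = a * d - b * c"
    by (simp add: assms(3) det_2)
  have ne: "a * d - b * c \<noteq> 0" using assms(4) det by simp
  show *: "\<forall>q\<in>Aff. g q (X1 q) = c\<^sup>2 - a\<^sup>2"
  proof
    fix q assume "q \<in> Aff"
    with assms(5) have "g q (1 *\<^sub>R X1 q + 0 *\<^sub>R X2 q) = - (a * 1 + b * 0)\<^sup>2 + (c * 1 + d * 0)\<^sup>2" by blast
    then show "g q (X1 q) = c\<^sup>2 - a\<^sup>2" by simp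
  qed
  define q where "q = (\<lambda>v::real \<times> real. - (a * fst v + b * snd v)\<^sup>2 + (c * fst v + d * snd v)\<^sup>2)"
  define n where "n = (1 / (a * d - b * c)\<^sup>2) *\<^sub>R (c * d - a * b, a\<^sup>2 - c\<^sup>2)"
  note model = half_space_model_lorentz_plane[OF ne, folded q_def n_def]
  interpret half_space_model q n by (rule model(1))
  have curvature: "(c\<^sup>2 - a\<^sup>2) / (a * d - b * c)\<^sup>2 = - q n"
    using model(3) by (simp only: q_def)
  have U: "half_space = Aff"
    by (simp add: half_space_def Aff_def model(2))
  have "g p = metric p" if "p \<in> Aff" for p
  proof
    fix v
    have y: "0 < snd p" using that by (simp add: Aff_def)
    have "v = (fst v / snd p) *\<^sub>R X1 p + (snd v / snd p) *\<^sub>R X2 p"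
      using y by (simp add: X1_def X2_def prod_eq_iff)
    then have "g p v = - (a * (fst v / snd p) + b * (snd v / snd p))\<^sup>2
        + (c * (fst v / snd p) + d * (snd v / snd p))\<^sup>2"
      using assms(5) that by metis
    also have "\<dots> = q v / (snd p)\<^sup>2"
      by (simp add: q_def power_divide diff_divide_distrib flip: add_divide_distrib)
    also have "\<dots> = metric p v" by (simp add: metric_def model(2))
    finally show "g p v = metric p v" .
  qed
  then have "has_constant_curvature Aff g ((c\<^sup>2 - a\<^sup>2) / (a * d - b * c)\<^sup>2)"
    using half_space_constant_curvature[unfolded U] curvature by simp
  moreover have "aff_id \<in> Aff" by (simp add: Aff_def aff_id_def)
  ultimately show "has_constant_curvature Aff g (g aff_id (X1 aff_id) / (det A)\<^sup>2)"
    using * det by simp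
qed

end
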